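(* Let $A:\Sigma\to\mathbb{R}$, $\Sigma=\{0,1\}^{\mathbb{N}}$, be a Hölder potential whose maximizing probability $\mu_{\infty,A}$ is unique, let $W$ be an involution kernel for $A$ satisfying the twist condition, and let $c(x,y)=I(x)-W(x,y)+\gamma$, where $I$ is the deviation function of $A$ and $\gamma\in\mathbb{R}$ is a constant. Suppose that the support $S$ of $\hat\mu_{max}$ (the natural extension of $\mu_{\infty,A}$) is a periodic orbit of $\hat\sigma$. Choose $(x_0,y_0)\in S$ such that $x_0$ is the smallest point of the projection of $S$ to the $x$-coordinate and $y_0$ is the smallest point of the fiber of $S$ over $x_0$, and for $z\in\Sigma$ let $$f(z)=\inf\Big\{\,c(z,y'_n)-c(x'_n,y'_n)+\sum_{i=0}^{n-1}\big(c(x'_{i+1},y'_i)-c(x'_i,y'_i)\big)\;:\;n\in\mathbb{N},\ (x'_j,y'_j)\in S\ (1\le j\le n)\Big\},$$ where $(x'_0,y'_0):=(x_0,y_0)$. Then for every $z\in\Sigma$ $$f(z)=\big(c(z,y_n)-c(x_n,y_n)\big)+\big(c(x_n,y_{n-1})-c(x_{n-1},y_{n-1})\big)+\dots+\big(c(x_2,y_1)-c(x_1,y_1)\big)+\big(c(x_1,y_0)-c(x_0,y_0)\big),$$ where $x_0<x_1<\dots<x_n$ are $x_0$ together with all the points of the support of $\mu_{\infty,A}$ which are strictly to the left of $z$ (i.e. $<z$), listed in increasing order, and for each $i$, $y_i$ is the point with $(x_i,y_i)\in S$. (In particular, if $z$ is itself a point of the support of $\mu_{\infty,A}$ other than $x_0$,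 then $x_n$ is the point of the support immediately preceding $z$.)
   Context: $\Sigma=\{0,1\}^{\mathbb{N}}$ is the one-sided full shift with points $x=(x_0,x_1,\dots)$, metric $d(x,x')=\lambda^{\min\{j:x_j\ne x'_j\}}$ for a fixed $\lambda\in(0,1)$, shift $\sigma(x_0,x_1,\dots)=(x_1,x_2,\dots)$, and lexicographic order ($x<z$ iff at the first index $i$ where they differ the symbol of $x$ is smaller). (In the claim $x_0,x_1,\dots,x_n$ denote points of $\Sigma$, not symbols.) The second factor of $\hat\Sigma=\Sigma\times\Sigma$ has points $y=(y_0,y_1,\dots)$, the same order, and shift $\sigma^*(y_0,y_1,\dots)=(y_1,y_2,\dots)$. With $\tau_y(x)=(y_0,x_0,x_1,\dots)$, the two-sided shift is $\hat\sigma(x,y)=(\sigma(x),(x_0,y_0,y_1,\dots))$, with inverse $\hat\sigma^{-1}(x,y)=(\tau_y(x),\sigma^*(y))$. $m(A)=\max\{\int A\,d\nu:\nu\ \sigma\text{-invariant Borel probability}\}$; an invariant probability attaining it is maximizing. A continuous $W:\hat\Sigma\to\mathbb{R}$ is an involution kernel for $A$ if $A(\tau_y(x))+W(\tau_y(x),\sigma^*(y))-W(x,y)$ does not depend on $x$. It satisfies the twist condition if for all $a<a'$ and $b<b'$ in $\Sigma$, $$W(a,b)+W(a',b')<W(a,b')+W(a',b).$$ Consequently $c(a,b)+c(a',b')>c(a,b')+c(a',b)$ for such points whenever the values are finite. The deviation function is $I(x)=\sum_{n\ge0}[V\circ\sigma-V-A+m(A)](\sigma^n(x))\in[0,\infty]$,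 where $V$ is a calibrated subaction, i.e. a continuous function with $V(x)=\max_{\sigma(z)=x}\{V(z)+A(z)-m(A)\}$ (unique up to an additive constant here); $I=0$ on the support of $\mu_{\infty,A}$. $\hat\mu_{max}$ is the natural extension of $\mu_{\infty,A}$: the unique $\hat\sigma$-invariant Borel probability on $\hat\Sigma$ with $x$-marginal $\mu_{\infty,A}$. When $S$ is a periodic orbit, each fiber of $S$ over a point of the support of $\mu_{\infty,A}$ is a single point. If $n=0$ in the displayed formula for $f(z)$, the right side is $c(z,y_0)-c(x_0,y_0)$. *)

theory Defs
  imports "HOL-Probability.Probability" "HOL-Library.Fun_Lexorder"
begin

(* Symbols 0 and 1 are False and True (with False < True).  The type carries the product
   topology of the discrete topology on bool, which is the topology of seq_dist below. *)
type_synonym point = "nat \<Rightarrow> bool"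

definition seq_dist :: "real \<Rightarrow> point \<Rightarrow> point \<Rightarrow> real" where
  "seq_dist lam x x' = (if x = x' then 0 else lam ^ (LEAST j. x j \<noteq> x' j))"

(* The library order < on functions is the pointwise one, hence less_fun. *)
abbreviation lex_less :: "point \<Rightarrow> point \<Rightarrow> bool" (infix \<open>\<prec>\<close> 50) where
  "x \<prec> z \<equiv> less_fun x z"

abbreviation lex_le :: "point \<Rightarrow> point \<Rightarrow> bool" (infix \<open>\<preceq>\<close> 50) where
  "x \<preceq> z \<equiv> x \<prec> z \<or> x = z"

definition holder :: "real \<Rightarrow> (point \<Rightarrow> real) \<Rightarrow> bool" where
  "holder lam A \<longleftrightarrow>
     (\<exists>C \<alpha>. 0 < \<alpha> \<and> \<alpha> \<le> 1 \<and> (\<forall>x x'. \<bar>A x - A x'\<bar> \<le> C * seq_dist lam x x' powr \<alpha>))"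

(* Used both for \<sigma> on the first factor and for \<sigma>* on the second. *)
definition shift :: "point \<Rightarrow> point" where
  "shift x = (\<lambda>n. x (Suc n))"

definition prepend :: "bool \<Rightarrow> point \<Rightarrow> point" where
  "prepend a x = case_nat a x"

definition tau :: "point \<Rightarrow> point \<Rightarrow> point" where
  "tau y x = prepend (y 0) x"

definition two_shift :: "point \<times> point \<Rightarrow> point \<times> point" where
  "two_shift = (\<lambda>(x, y). (shift x, prepend (x 0) y))"

definition invariant_prob :: "('a::topological_space \<Rightarrow> 'a) \<Rightarrow> 'a measure \<Rightarrow> bool" where
  "invariant_prob T \<nu> \<longleftrightarrow> prob_space \<nu> \<and> sets \<nu> = sets borel \<and> distr \<nu> borel T = \<nu>"

definition measure_support :: "'a::topological_space measure \<Rightarrow> 'a set" where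
  "measure_support \<nu> = {x. \<forall>U. open U \<longrightarrow> x \<in> U \<longrightarrow> 0 < emeasure \<nu> U}"

definition max_value :: "(point \<Rightarrow> real) \<Rightarrow> real" where
  "max_value A = (SUP \<nu>\<in>{\<nu>. invariant_prob shift \<nu>}. \<integral>x. A x \<partial>\<nu>)"

definition maximizing :: "(point \<Rightarrow> real) \<Rightarrow> point measure \<Rightarrow> bool" where
  "maximizing A \<nu> \<longleftrightarrow> invariant_prob shift \<nu> \<and> (\<integral>x. A x \<partial>\<nu>) = max_value A"

definition natural_extension :: "point measure \<Rightarrow> (point \<times> point) measure \<Rightarrow> bool" where
  "natural_extension \<mu> \<mu>hat \<longleftrightarrow> invariant_prob two_shift \<mu>hat \<and> distr \<mu>hat borel fst = \<mu>"

definition periodic_orbit :: "('a \<Rightarrow> 'a) \<Rightarrow> 'a set \<Rightarrow> bool" where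
  "periodic_orbit T S \<longleftrightarrow> (\<exists>p k. 0 < k \<and> (T ^^ k) p = p \<and> S = range (\<lambda>i. (T ^^ i) p))"

definition involution_kernel :: "(point \<Rightarrow> real) \<Rightarrow> (point \<times> point \<Rightarrow> real) \<Rightarrow> bool" where
  "involution_kernel A W \<longleftrightarrow> continuous_on UNIV W \<and>
     (\<forall>y x x'. A (tau y x) + W (tau y x, shift y) - W (x, y) =
               A (tau y x') + W (tau y x', shift y) - W (x', y))"

definition twist :: "(point \<times> point \<Rightarrow> real) \<Rightarrow> bool" where
  "twist W \<longleftrightarrow> (\<forall>a a' b b'. a \<prec> a' \<longrightarrow> b \<prec> b' \<longrightarrow>
     W (a, b) + W (a', b') < W (a, b') + W (a', b))"

definition calibrated_subaction :: "(point \<Rightarrow> real) \<Rightarrow> (point \<Rightarrow> real) \<Rightarrow> bool" where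
  "calibrated_subaction A V \<longleftrightarrow> continuous_on UNIV V \<and>
     (\<forall>x. V x = Max ((\<lambda>z. V z + A z - max_value A) ` {z. shift z = x}))"

definition deviation :: "(point \<Rightarrow> real) \<Rightarrow> (point \<Rightarrow> real) \<Rightarrow> point \<Rightarrow> ereal" where
  "deviation A V x = (\<Sum>n. let u = (shift ^^ n) x
                           in ereal (V (shift u) - V u - A u + max_value A))"

definition cost :: "(point \<Rightarrow> real) \<Rightarrow> (point \<Rightarrow> real) \<Rightarrow> (point \<times> point \<Rightarrow> real) \<Rightarrow> real
    \<Rightarrow> point \<Rightarrow> point \<Rightarrow> ereal" where
  "cost A V W \<gamma> x y = deviation A V x - ereal (W (x, y)) + ereal \<gamma>"

definition chain_sum :: "(point \<Rightarrow> point \<Rightarrow> ereal) \<Rightarrow> point \<Rightarrow> nat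
    \<Rightarrow> (nat \<Rightarrow> point) \<Rightarrow> (nat \<Rightarrow> point) \<Rightarrow> ereal" where
  "chain_sum c z n X Y =
     (c z (Y n) - c (X n) (Y n)) + (\<Sum>i<n. c (X (Suc i)) (Y i) - c (X i) (Y i))"

definition chain_inf :: "(point \<Rightarrow> point \<Rightarrow> ereal) \<Rightarrow> (point \<times> point) set
    \<Rightarrow> point \<Rightarrow> point \<Rightarrow> point \<Rightarrow> ereal" where
  "chain_inf c S x0 y0 z =
     Inf {chain_sum c z n X Y | n X Y.
            X 0 = x0 \<and> Y 0 = y0 \<and> (\<forall>j\<in>{1..n}. (X j, Y j) \<in> S)}"

(* X 0, ..., X n is the increasing list of x0 and the points of P strictly below z,
   and each Y i lies in the fiber of S over X i. *)
definition left_list :: "point set \<Rightarrow> (point \<times> point) set \<Rightarrow> point \<Rightarrow> point \<Rightarrow> nat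
    \<Rightarrow> (nat \<Rightarrow> point) \<Rightarrow> (nat \<Rightarrow> point) \<Rightarrow> bool" where
  "left_list P S x0 z n X Y \<longleftrightarrow>
     (\<forall>i<n. X i \<prec> X (Suc i)) \<and>
     X ` {..n} = insert x0 {x \<in> P. x \<prec> z} \<and>
     (\<forall>i\<le>n. (X i, Y i) \<in> S)"

end

theory Submission
  imports Defs
begin

text \<open>
  Write \<open>P\<close> for the support of \<open>\<mu>\<close>. It is the projection of \<open>S\<close>
  (\<open>measure_support_marginal\<close>), hence finite and shift invariant. The function
  \<open>V \<circ> \<sigma> - V - A + m(A)\<close> (\<open>defect\<close>) is nonnegative because \<open>V\<close> is calibrated, and
  its integral against \<open>\<mu>\<close> is \<open>0\<close>, so by continuity it vanishes on \<open>P\<close>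
  (\<open>defect_zero_on_support\<close>). Thus the deviation vanishes on \<open>P\<close>, and the cost of a chain is
  \<open>I(z)\<close>, the same for all chains, plus a finite sum of increments \<open>W(x_i, y_i) - W(x_{i+1}, y_i)\<close>
  (\<open>chain_sum_cost\<close>). It remains to minimize this sum.

  The orbit \<open>S\<close> is the graph of a nonincreasing function. It is a graph because going once around the
  orbit writes more and more symbols of \<open>x\<close> into \<open>y\<close>, so \<open>x\<close> determines \<open>y\<close>
  (\<open>two_shift_periodic_fiber\<close>). For the monotonicity, fix \<open>(a, b)\<close> in \<open>S\<close> and compare
  \<open>W(u, y) - V(u)\<close> along the backward orbits of \<open>(u, b)\<close> and of \<open>(a, b)\<close>. By the equation of the
  involution kernel, the difference of the two values grows at each step by a defect, which is
  nonnegative; and it tends to \<open>0\<close>, because both backward orbits have the same second coordinates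
  and first coordinates that agree on ever longer prefixes. Hence \<open>u \<mapsto> W(u, b) - V(u)\<close> is maximal at
  \<open>a\<close> (\<open>kernel_minus_subaction_le_periodic\<close>). Adding two such inequalities shows that exchanging
  the partners of two points of \<open>S\<close> cannot increase the sum of \<open>W\<close>; the twist condition says
  that it does increase when both coordinates are ordered the same way. So \<open>y\<close> does not
  increase with \<open>x\<close> (\<open>periodic_support_antitone\<close>).

  Finally let \<open>e 0, ..., e N\<close> be \<open>P\<close> in increasing order, with partners \<open>h 0, ..., h N\<close>, which
  do not increase. The twist condition says that \<open>W(a, b) - W(a', b)\<close> with \<open>a \<preceq> a'\<close> is monotone in \<open>b\<close>.
  A jump of a chain from \<open>e k\<close> to a point further right is therefore not cheaper than
  climbing through all intermediate points, where no step is paid with a larger second coordinate;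
  and a jump to the left refunds at most what the climb had cost. Summing up, the chain costs at least
  as much as the direct climb from \<open>e 0 = x0\<close> to \<open>z\<close> (\<open>staircase_le_chain\<close>), and that climb is the
  chain in the formula.
\<close>

section \<open>The lexicographic order\<close>

lemma lex_linear: "x \<prec> z \<or> x = z \<or> z \<prec> x" for x z :: point
proof (cases "x = z")
  case False
  then have ex: "\<exists>k. x k \<noteq> z k" by auto
  define k where "k = (LEAST k. x k \<noteq> z k)"
  have "x k \<noteq> z k" using LeastI_ex[OF ex] by (simp add: k_def)
  moreover have "\<And>k'. k' < k \<Longrightarrow> x k' = z k'" using not_less_Least by (force simp: k_def)
  ultimately show ?thesis unfolding less_fun_def by (metis linorder_neqE)
qed simp

text \<open>The class order on functions is the pointwise one, which is not linear, so the induction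
  principles for finite linearly ordered sets are obtained by an interpretation.\<close>

interpretation lex: linorder "\<lambda>x z :: point. x \<preceq> z" "less_fun"
proof -
  interpret order "\<lambda>x z :: point. x \<preceq> z" "less_fun" by (rule order_less_fun)
  show "class.linorder (\<lambda>x z :: point. x \<preceq> z) less_fun"
    by unfold_locales (use lex_linear in auto)
qed

text \<open>Used twice: from a single point it produces the list of the points to the left of \<open>z\<close>, and from
  any such list it produces an enumeration of the whole support. Extending the given list avoids
  having to show that increasing enumerations are unique.\<close>

lemma extend_enumeration:
  fixes e :: "nat \<Rightarrow> point"
  assumes "finite R" and "\<forall>i<n. e i \<prec> e (Suc i)" and "\<forall>i\<le>n. \<forall>r\<in>R. e i \<prec> r"
  shows "\<exists>N e'. n \<le> N \<and> (\<forall>i\<le>n. e' i = e i) \<and> (\<forall>i<N. e' i \<prec> e' (Suc i)) \<and>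
           e' ` {..N} = e ` {..n} \<union> R"
  using assms(1,3)
proof (induction R rule: lex.finite_linorder_max_induct)
  case empty
  show ?case using assms(2) by (intro exI[of _ n] exI[of _ e]) auto
next
  case (insert b R)
  then obtain N and e' :: "nat \<Rightarrow> point" where IH: "n \<le> N" "\<forall>i\<le>n. e' i = e i" "\<forall>i<N. e' i \<prec> e' (Suc i)"
    "e' ` {..N} = e ` {..n} \<union> R" by auto
  have "e' N \<in> e ` {..n} \<union> R" using IH(4) by blast
  then have "e' N \<prec> b" using insert by auto
  moreover have "(e'(Suc N := b)) ` {..Suc N} = insert b (e' ` {..N})"
    by (auto simp: atMost_Suc image_iff)
  ultimately show ?case using IH
    by (intro exI[of _ "Suc N"] exI[of _ "e'(Suc N := b)"]) (auto simp: less_Suc_eq)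
qed

lemma lex_mono_enumeration:
  fixes e :: "nat \<Rightarrow> point"
  assumes inc: "\<forall>i<N. e i \<prec> e (Suc i)" and "i < j" "j \<le> N"
  shows "e i \<prec> e j"
  using assms(2,3)
proof (induction j)
  case (Suc j)
  then have "e j \<prec> e (Suc j)" using inc by auto
  moreover have "i = j \<or> e i \<prec> e j" using Suc by (auto simp: less_Suc_eq)
  ultimately show ?case by (auto intro: less_fun_trans)
qed simp

section \<open>Chains against the staircase\<close>

text \<open>The form in which the twist condition is used: the price of moving right from \<open>a\<close> to \<open>a'\<close> does
  not decrease when the second coordinate increases.\<close>

lemma twist_decrement:
  fixes a a' b b' :: point
  assumes "twist W" and "a \<preceq> a'" and "b' \<preceq> b"
  shows "W (a, b') - W (a', b') \<le> W (a, b) - W (a', b)"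
proof (cases "a = a' \<or> b' = b")
  case False
  with assms have "W (a, b') + W (a', b) < W (a, b) + W (a', b')"
    unfolding twist_def by blast
  then show ?thesis by simp
qed auto

text \<open>The finite part of the cost of a chain, without its last step.\<close>

definition staircase :: "(point \<times> point \<Rightarrow> real) \<Rightarrow> (nat \<Rightarrow> point) \<Rightarrow> (nat \<Rightarrow> point) \<Rightarrow> nat \<Rightarrow> real" where
  "staircase W e h j = (\<Sum>i<j. W (e i, h i) - W (e (Suc i), h i))"

text \<open>Both directions telescope \<open>W (e k, h k) - W (e l, h k)\<close> over consecutive points and compare termwise:
  to the right of \<open>k\<close> the staircase uses second coordinates at most \<open>h k\<close>, so its steps are not
  dearer; to the left it uses second coordinates at least \<open>h k\<close>, so its steps are not cheaper, but
  they enter with the opposite sign.\<close>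

lemma staircase_step:
  fixes e h :: "nat \<Rightarrow> point"
  assumes tw: "twist W" and inc: "\<forall>i<N. e i \<prec> e (Suc i)"
    and dec: "\<forall>j\<le>N. \<forall>i\<le>j. h j \<preceq> h i"
    and "k \<le> N" "l \<le> N"
  shows "staircase W e h l \<le> staircase W e h k + (W (e k, h k) - W (e l, h k))"
proof (cases "k \<le> l")
  case True
  then show ?thesis using \<open>l \<le> N\<close>
  proof (induction l rule: dec_induct)
    case (step l)
    then have "W (e l, h l) - W (e (Suc l), h l) \<le> W (e l, h k) - W (e (Suc l), h k)"
      using inc dec by (intro twist_decrement[OF tw]) auto
    with step show ?case by (simp add: staircase_def)
  qed simp
next
  case False
  then have "l \<le> k" by simp
  then show ?thesis
  proof (induction l rule: inc_induct)
    case (step l)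
    then have "W (e l, h k) - W (e (Suc l), h k) \<le> W (e l, h l) - W (e (Suc l), h l)"
      using inc dec \<open>k \<le> N\<close> by (intro twist_decrement[OF tw]) auto
    with step show ?case by (simp add: staircase_def)
  qed simp
qed

text \<open>The target \<open>z\<close> is an arbitrary point, not necessarily one of the \<open>e i\<close>; it lies between \<open>e n\<close>
  and \<open>e (Suc n)\<close>. If the last jump starts at or before \<open>e n\<close>, the climb continues from \<open>e n\<close> to the right;
  if it starts after \<open>e n\<close>, the jump is routed through \<open>e (Suc n)\<close>, from where it goes left.
  For \<open>n = 0\<close> the point \<open>z\<close> may also lie to the left of \<open>e 0\<close> or coincide with it.\<close>

lemma staircase_last_step:
  fixes e h :: "nat \<Rightarrow> point"
  assumes tw: "twist W" and inc: "\<forall>i<N. e i \<prec> e (Suc i)"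
    and dec: "\<forall>j\<le>N. \<forall>i\<le>j. h j \<preceq> h i"
    and "k \<le> N" "n \<le> N"
    and left: "n = 0 \<or> e n \<prec> (z :: point)" and right: "n < N \<Longrightarrow> z \<preceq> e (Suc n)"
  shows "staircase W e h n + (W (e n, h n) - W (z, h n))
       \<le> staircase W e h k + (W (e k, h k) - W (z, h k))"
proof (cases "k \<le> n")
  case True
  note s = staircase_step[OF tw inc dec \<open>k \<le> N\<close> \<open>n \<le> N\<close>]
  show ?thesis
  proof (cases "e n \<prec> z")
    case True
    then have "W (e n, h n) - W (z, h n) \<le> W (e n, h k) - W (z, h k)"
      using dec \<open>k \<le> n\<close> \<open>n \<le> N\<close> by (intro twist_decrement[OF tw]) auto
    with s show ?thesis by simp
  next
    case False
    with left True show ?thesis by simp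
  qed
next
  case False
  then have "Suc n \<le> N" using \<open>k \<le> N\<close> by simp
  note s = staircase_step[OF tw inc dec \<open>k \<le> N\<close> this]
  have "W (z, h k) - W (e (Suc n), h k) \<le> W (z, h n) - W (e (Suc n), h n)"
    using dec False \<open>k \<le> N\<close> right by (intro twist_decrement[OF tw]) auto
  with s show ?thesis by (simp add: staircase_def)
qed

lemma staircase_le_chain:
  fixes e h :: "nat \<Rightarrow> point"
  assumes tw: "twist W" and inc: "\<forall>i<N. e i \<prec> e (Suc i)"
    and dec: "\<forall>j\<le>N. \<forall>i\<le>j. h j \<preceq> h i"
    and "n \<le> N" and left: "n = 0 \<or> e n \<prec> (z :: point)" and right: "n < N \<Longrightarrow> z \<preceq> e (Suc n)"
    and k: "k 0 = 0" "\<And>j. j \<le> m \<Longrightarrow> k j \<le> N"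
  shows "staircase W e h n + (W (e n, h n) - W (z, h n))
       \<le> staircase W (e \<circ> k) (h \<circ> k) m + (W (e (k m), h (k m)) - W (z, h (k m)))"
proof -
  have "staircase W e h (k m) \<le> staircase W (e \<circ> k) (h \<circ> k) m"
    using k(2)
  proof (induction m)
    case 0
    show ?case using k by (simp add: staircase_def)
  next
    case (Suc m)
    have "staircase W e h (k (Suc m))
        \<le> staircase W e h (k m) + (W (e (k m), h (k m)) - W (e (k (Suc m)), h (k m)))"
      using Suc.prems by (intro staircase_step[OF tw inc dec]) auto
    also have "\<dots> \<le> staircase W (e \<circ> k) (h \<circ> k) (Suc m)"
      using Suc by (simp add: staircase_def)
    finally show ?case .
  qed
  moreover have "staircase W e h n + (W (e n, h n) - W (z, h n))
       \<le> staircase W e h (k m) + (W (e (k m), h (k m)) - W (z, h (k m)))"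
    using k by (intro staircase_last_step[OF tw inc dec _ \<open>n \<le> N\<close> left right]) auto
  ultimately show ?thesis by simp
qed

text \<open>The term \<open>deviation A V z\<close>, the only one that may be infinite, is separated from a real number
  that carries all the dependence on the chain.\<close>

lemma chain_sum_cost:
  assumes "\<forall>i\<le>n. deviation A V (X i) = 0"
  shows "chain_sum (cost A V W \<gamma>) z n X Y =
    deviation A V z + ereal (staircase W X Y n + (W (X n, Y n) - W (z, Y n)))"
proof -
  have "(\<Sum>i<n. cost A V W \<gamma> (X (Suc i)) (Y i) - cost A V W \<gamma> (X i) (Y i))
      = (\<Sum>i<n. ereal (W (X i, Y i) - W (X (Suc i), Y i)))"
    using assms by (intro sum.cong) (auto simp: cost_def)
  then show ?thesis using assms
    by (cases "deviation A V z") (auto simp: chain_sum_def cost_def staircase_def)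
qed

section \<open>Topology of the shift space\<close>

text \<open>This makes the space of points second countable, so that the complement of the support of a
  measure is a countable union of null sets.\<close>

instance bool :: second_countable_topology
proof
  have "open S = generate_topology UNIV S" for S :: "bool set"
    using Topological_Spaces.open_discrete[of S] generate_topology.Basis[of S UNIV] by blast
  then have "open = generate_topology (UNIV :: bool set set)" ..
  then show "\<exists>B :: bool set set. countable B \<and> open = generate_topology B"
    by (intro exI[of _ UNIV]) simp
qed

lemma tendsto_pointI:
  fixes X :: "'b \<Rightarrow> point"
  assumes "\<And>i. eventually (\<lambda>n. X n i = x i) F"
  shows "(X \<longlongrightarrow> x) F"
proof -
  have "limitin (product_topology (\<lambda>i. euclidean) UNIV) X x F"
    unfolding limitin_componentwise
    using assms by (auto intro: tendsto_eventually)
  then show ?thesis by (simp add: euclidean_product_topology)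
qed

lemma continuous_on_coordinate: "continuous_on UNIV (\<lambda>u :: point. u i)"
  by (rule continuous_on_product_then_coordinatewise) (rule continuous_on_id)

lemma closed_finite_points:
  fixes F :: "point set"
  assumes "finite F"
  shows "closed F"
proof -
  have "closed {x}" for x :: point
  proof -
    have "{x} = (\<Inter>i. (\<lambda>u. u i) -` {x i})" by auto
    moreover have "closed ((\<lambda>u :: point. u i) -` {x i})" for i
      by (intro closed_vimage continuous_on_coordinate)
        (simp add: closed_def Topological_Spaces.open_discrete)
    ultimately show ?thesis by (simp add: closed_INT)
  qed
  with assms have "closed (\<Union>x\<in>F. {x})" by (intro closed_UN) auto
  then show ?thesis by simp
qed

lemma continuous_on_shift: "continuous_on UNIV shift"
  unfolding shift_def
  by (intro continuous_on_coordinatewise_then_product continuous_on_coordinate)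

lemma measure_support_compl_null:
  fixes M :: "'a :: second_countable_topology measure"
  assumes "sets M = sets borel"
  shows "- measure_support M \<in> null_sets M"
proof -
  define \<F> where "\<F> = {U. open U \<and> emeasure M U = 0}"
  obtain \<G> where G: "\<G> \<subseteq> \<F>" "countable \<G>" "\<Union>\<G> = \<Union>\<F>"
    using Lindelof[of \<F>] unfolding \<F>_def by blast
  have "\<Union>\<G> \<in> null_sets M"
  proof -
    have "(\<Union>U\<in>\<G>. U) \<in> null_sets M"
      using G assms by (intro null_sets_UN') (auto simp: \<F>_def null_sets_def)
    then show ?thesis by simp
  qed
  moreover have "- measure_support M = \<Union>\<F>"
    by (auto simp: measure_support_def \<F>_def zero_less_iff_neq_zero)
  ultimately show ?thesis using G by simp
qed

text \<open>A projection of a support need not be closed; here it is, because it is finite.\<close>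

lemma measure_support_marginal:
  assumes "natural_extension \<mu> \<mu>hat" and "finite (measure_support \<mu>hat)"
  shows "measure_support \<mu> = fst ` measure_support \<mu>hat"
proof -
  have sets: "sets \<mu>hat = sets borel" and marg: "\<mu> = distr \<mu>hat borel fst"
    using assms by (auto simp: natural_extension_def invariant_prob_def)
  have space: "space \<mu>hat = UNIV" using sets_eq_imp_space_eq[OF sets] by simp
  have fst_meas: "fst \<in> measurable \<mu>hat (borel :: point measure)"
    using sets by (subst measurable_cong_sets[OF sets refl])
      (intro borel_measurable_continuous_onI continuous_intros)
  have em: "emeasure \<mu> U = emeasure \<mu>hat (fst -` U)" if "open U" for U
    using that fst_meas by (simp add: marg emeasure_distr space)
  show ?thesis
  proof (intro equalityI subsetI)
    fix x assume "x \<in> fst ` measure_support \<mu>hat"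
    then obtain y where y: "(x, y) \<in> measure_support \<mu>hat" by auto
    have "0 < emeasure \<mu> U" if "open U" "x \<in> U" for U
    proof -
      have "open (fst -` U :: (point \<times> point) set)"
        using that by (intro open_vimage_fst)
      then show ?thesis using y that by (auto simp: em measure_support_def)
    qed
    then show "x \<in> measure_support \<mu>" by (auto simp: measure_support_def)
  next
    fix x assume x: "x \<in> measure_support \<mu>"
    show "x \<in> fst ` measure_support \<mu>hat"
    proof (rule ccontr)
      assume "x \<notin> fst ` measure_support \<mu>hat"
      moreover have op: "open (- (fst ` measure_support \<mu>hat))"
        using assms(2) closed_finite_points by blast
      ultimately have "0 < emeasure \<mu> (- (fst ` measure_support \<mu>hat))"
        using x by (auto simp: measure_support_def)
      also have "\<dots> = emeasure \<mu>hat (fst -` (- (fst ` measure_support \<mu>hat)))"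
        using em[OF op] .
      also have "\<dots> \<le> emeasure \<mu>hat (- measure_support \<mu>hat)"
        using measure_support_compl_null[OF sets] by (intro emeasure_mono) auto
      also have "\<dots> = 0" using measure_support_compl_null[OF sets] by auto
      finally show False by simp
    qed
  qed
qed

section \<open>The defect of a calibrated subaction\<close>

definition defect :: "(point \<Rightarrow> real) \<Rightarrow> (point \<Rightarrow> real) \<Rightarrow> point \<Rightarrow> real" where
  "defect A V u = V (shift u) - V u - A u + max_value A"

lemma shift_prepend [simp]: "shift (prepend a x) = x"
  by (simp add: shift_def prepend_def)

lemma prepend_0 [simp]: "prepend a x 0 = a"
  by (simp add: prepend_def)

lemma prepend_shift [simp]: "prepend (u 0) (shift u) = u"
  by (rule ext) (simp add: shift_def prepend_def split: nat.split)

text \<open>The maximum in the definition of a calibrated subaction is taken by \<open>Max\<close>, which is only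
  an upper bound for finite sets.\<close>

lemma finite_preimages_shift: "finite {z. shift z = x}"
proof (rule finite_subset)
  show "{z. shift z = x} \<subseteq> (\<lambda>a. prepend a x) ` UNIV"
    using prepend_shift by (metis (mono_tags, lifting) mem_Collect_eq rangeI subsetI)
qed simp

lemma defect_nonneg:
  assumes "calibrated_subaction A V"
  shows "0 \<le> defect A V u"
proof -
  have "V u + A u - max_value A \<le> V (shift u)"
    using assms finite_preimages_shift unfolding calibrated_subaction_def
    by (metis (mono_tags, lifting) Max_ge finite_imageI image_eqI mem_Collect_eq)
  then show ?thesis by (simp add: defect_def)
qed

text \<open>The equation of the kernel expresses \<open>A\<close> through the continuous \<open>W\<close>: comparing \<open>x\<close> with a
  fixed point that depends only on the first symbol of \<open>y\<close> leaves a remainder that is locally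
  constant.\<close>

lemma involution_kernel_continuous:
  assumes "involution_kernel A W"
  shows "continuous_on UNIV A"
proof -
  \<comment> \<open>The constant sequence serves both as the second coordinate with a prescribed first symbol and
    as the reference point in the first coordinate.\<close>
  define K :: "bool \<Rightarrow> point" where "K a = (\<lambda>_. a)" for a
  define B where "B a = A (prepend a (K a)) + W (prepend a (K a), K a) - W (K a, K a)" for a
  have W: "continuous_on UNIV W" using assms unfolding involution_kernel_def by blast
  have "A u = W (shift u, K (u 0)) - W (u, K (u 0)) + B (u 0)" for u
  proof -
    have "tau (K a) x = prepend a x" "shift (K a) = K a" for a x
      by (auto simp: tau_def K_def shift_def)
    then have "A (prepend (u 0) (shift u)) + W (prepend (u 0) (shift u), K (u 0)) - W (shift u, K (u 0)) = B (u 0)"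
      using assms unfolding involution_kernel_def B_def by metis
    then show ?thesis by simp
  qed
  moreover have "continuous_on UNIV (\<lambda>u. W (shift u, K (u 0)) - W (u, K (u 0)) + B (u 0))"
  proof -
    note c0 = continuous_on_coordinate[of 0]
    have cK: "continuous_on UNIV (\<lambda>u :: point. K (u 0))"
      unfolding K_def by (intro continuous_on_coordinatewise_then_product c0)
    have cB: "continuous_on UNIV (\<lambda>u :: point. B (u 0))"
      by (rule continuous_on_compose2[OF _ c0, of UNIV]) (auto simp: continuous_on_discrete)
    show ?thesis
      by (intro continuous_on_add continuous_on_diff cB continuous_on_compose2[OF W]
          continuous_on_Pair continuous_on_shift cK continuous_on_id) auto
  qed
  ultimately show ?thesis by simp
qed

text \<open>By invariance \<open>V \<circ> \<sigma>\<close> and \<open>V\<close> have the same integral, and \<open>\<integral>A = m(A)\<close>, so the nonnegative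
  defect has integral \<open>0\<close>. It vanishes almost everywhere, and by continuity at every point of the
  support.\<close>

lemma defect_zero_on_support:
  assumes max: "maximizing A \<mu>" and cal: "calibrated_subaction A V" and A: "continuous_on UNIV A"
    and fin: "finite (measure_support \<mu>)" and x: "x \<in> measure_support \<mu>"
  shows "defect A V x = 0"
proof -
  have inv: "distr \<mu> borel shift = \<mu>" and sets: "sets \<mu> = sets borel"
    and prob: "prob_space \<mu>" and int: "(\<integral>x. A x \<partial>\<mu>) = max_value A"
    using max by (auto simp: maximizing_def invariant_prob_def)
  interpret prob_space \<mu> by (rule prob)
  have V: "continuous_on UNIV V" using cal unfolding calibrated_subaction_def by blast
  have meas: "f \<in> borel_measurable \<mu>" if "continuous_on UNIV f" for f :: "point \<Rightarrow> 'b :: topological_space"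
    using that by (subst measurable_cong_sets[OF sets refl]) (rule borel_measurable_continuous_onI)
  \<comment> \<open>Continuous functions are essentially bounded, as almost every point lies in the finite support.\<close>
  have integ: "integrable \<mu> f" if "continuous_on UNIV f" for f :: "point \<Rightarrow> real"
  proof (rule integrable_const_bound)
    show "AE u in \<mu>. norm (f u) \<le> Max ((\<lambda>u. norm (f u)) ` measure_support \<mu>)"
      by (rule AE_I'[OF measure_support_compl_null[OF sets]]) (use fin in auto)
  qed (rule meas[OF that])
  have Vs: "continuous_on UNIV (\<lambda>u. V (shift u))"
    by (rule continuous_on_compose2[OF V continuous_on_shift]) auto
  have D: "continuous_on UNIV (defect A V)"
    unfolding defect_def by (intro continuous_intros Vs V A)
  have "(\<integral>u. V (shift u) \<partial>\<mu>) = (\<integral>u. V u \<partial>distr \<mu> borel shift)"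
    by (rule integral_distr[symmetric])
      (auto intro: meas continuous_on_shift borel_measurable_continuous_onI V)
  then have "(\<integral>u. defect A V u \<partial>\<mu>) = 0"
    unfolding defect_def inv
    using integ[OF Vs] integ[OF V] integ[OF A] int by (simp add: prob_space)
  then have "AE u in \<mu>. defect A V u = 0"
    using integral_nonneg_eq_0_iff_AE[OF integ[OF D]] defect_nonneg[OF cal] by auto
  moreover have op: "open (defect A V -` (- {0}))"
    using D by (intro open_vimage) auto
  ultimately have "emeasure \<mu> (defect A V -` (- {0})) = 0"
    using sets sets_eq_imp_space_eq[OF sets]
    by (subst (asm) AE_iff_measurable[OF _ refl]) (auto simp: vimage_def)
  then show ?thesis using x op unfolding measure_support_def by fastforce
qed

lemma deviation_zero:
  assumes "\<And>n. defect A V ((shift ^^ n) x) = 0"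
  shows "deviation A V x = 0"
proof -
  have "(\<lambda>n. let u = (shift ^^ n) x in ereal (V (shift u) - V u - A u + max_value A)) = (\<lambda>n. 0)"
    using assms by (auto simp: defect_def Let_def)
  then show ?thesis unfolding deviation_def by simp
qed

section \<open>The two-sided shift\<close>

text \<open>The inverse of the two-sided shift.\<close>

definition backward :: "point \<times> point \<Rightarrow> point \<times> point" where
  "backward = (\<lambda>(x, y). (tau y x, shift y))"

lemma backward_two_shift [simp]: "backward (two_shift q) = q"
  by (cases q) (simp add: backward_def two_shift_def tau_def)

lemma backward_iter_two_shift_iter: "(backward ^^ j) ((two_shift ^^ j) q) = q"
proof (induction j)
  case (Suc j)
  have "(backward ^^ Suc j) u = (backward ^^ j) (backward u)" for u
    by (simp add: funpow_swap1)
  from this[of "(two_shift ^^ Suc j) q"] Suc show ?case by simp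
qed simp

lemma snd_two_shift_iter:
  "snd ((two_shift ^^ j) (x, y)) i = (if i < j then x (j - 1 - i) else y (i - j))"
proof -
  have f: "fst ((two_shift ^^ j) (x, y)) i = x (i + j)" for i j
    by (induction j arbitrary: i) (auto simp: two_shift_def shift_def split: prod.splits)
  show ?thesis
  proof (induction j arbitrary: i)
    case (Suc j)
    have "snd ((two_shift ^^ Suc j) (x, y)) =
        prepend (fst ((two_shift ^^ j) (x, y)) 0) (snd ((two_shift ^^ j) (x, y)))"
      by (simp add: two_shift_def split: prod.split)
    then show ?case using Suc by (cases i) (auto simp: prepend_def f)
  qed simp
qed

lemma snd_backward_iter: "snd ((backward ^^ j) (x, y)) i = y (i + j)"
  by (induction j arbitrary: i) (auto simp: backward_def shift_def split: prod.splits)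

lemma fst_backward_iter:
  "fst ((backward ^^ j) (x, y)) i = (if i < j then y (j - 1 - i) else x (i - j))"
proof (induction j arbitrary: i)
  case (Suc j)
  have "fst ((backward ^^ Suc j) (x, y)) =
      prepend (snd ((backward ^^ j) (x, y)) 0) (fst ((backward ^^ j) (x, y)))"
    by (simp add: backward_def tau_def split: prod.split)
  then show ?case using Suc by (cases i) (auto simp: prepend_def snd_backward_iter)
qed simp

lemma funpow_fixed_multiple: "(f ^^ k) q = q \<Longrightarrow> (f ^^ (k * m)) q = q"
  by (induction m) (simp_all add: funpow_add)

text \<open>After \<open>j > i\<close> steps the \<open>i\<close>-th symbol of the second coordinate has been copied from \<open>x\<close>;
  a multiple of the period that exceeds \<open>i\<close> recovers it from \<open>x\<close> alone.\<close>

lemma two_shift_periodic_fiber: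
  assumes "(two_shift ^^ k) (x, y) = (x, y)" "(two_shift ^^ k) (x, y') = (x, y')" "0 < k"
  shows "y = y'"
proof
  fix i
  have "i < k * Suc i" using mult_le_mono1[of 1 k "Suc i"] \<open>0 < k\<close> by simp
  then show "y i = y' i"
    using funpow_fixed_multiple[OF assms(1), of "Suc i"]
      funpow_fixed_multiple[OF assms(2), of "Suc i"]
      snd_two_shift_iter[of "k * Suc i" x y i] snd_two_shift_iter[of "k * Suc i" x y' i]
    by simp
qed

lemma periodic_orbitD:
  assumes "periodic_orbit T S"
  obtains k where "0 < k" "finite S" "\<And>q. q \<in> S \<Longrightarrow> (T ^^ k) q = q" "\<And>q. q \<in> S \<Longrightarrow> T q \<in> S"
proof -
  obtain p k where k: "0 < k" and p: "(T ^^ k) p = p" and S: "S = range (\<lambda>i. (T ^^ i) p)"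
    using assms unfolding periodic_orbit_def by auto
  have "S \<subseteq> (\<lambda>i. (T ^^ i) p) ` {..<k}"
  proof
    fix q assume "q \<in> S"
    then obtain i where "q = (T ^^ i) p" using S by auto
    then have "q = (T ^^ (i mod k)) p" using funpow_mod_eq[OF p] by metis
    then show "q \<in> (\<lambda>i. (T ^^ i) p) ` {..<k}" using k by auto
  qed
  then have "finite S" by (rule finite_subset) simp
  moreover have "(T ^^ k) q = q" if q: "q \<in> S" for q
  proof -
    obtain i where i: "q = (T ^^ i) p" using S q by auto
    have "(T ^^ k) ((T ^^ i) p) = (T ^^ i) ((T ^^ k) p)"
      by (metis add.commute comp_apply funpow_add)
    with i p show ?thesis by simp
  qed
  moreover have "T q \<in> S" if q: "q \<in> S" for q
  proof -
    obtain i where "q = (T ^^ i) p" using S q by auto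
    then have "T q = (T ^^ Suc i) p" by simp
    then show ?thesis using S by blast
  qed
  ultimately show thesis using k that by blast
qed

text \<open>By the equation of the kernel the change of \<open>W\<close> and \<open>A\<close> in one backward step is the same for
  \<open>x\<close> and for \<open>x'\<close>. Rewriting \<open>A\<close> by the definition of the defect leaves the defect at \<open>tau y x\<close>
  as the only discrepancy.\<close>

lemma kernel_defect_step:
  assumes inv: "involution_kernel A W" and cal: "calibrated_subaction A V"
    and zero: "defect A V (tau y x') = 0"
  shows "(W (x, y) - V x) - (W (x', y) - V x')
       \<le> (W (tau y x, shift y) - V (tau y x)) - (W (tau y x', shift y) - V (tau y x'))"
proof -
  have s: "shift (tau y u) = u" for u by (simp add: tau_def)
  have "A (tau y x) + W (tau y x, shift y) - W (x, y) =
      A (tau y x') + W (tau y x', shift y) - W (x', y)"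
    using inv unfolding involution_kernel_def by blast
  with zero defect_nonneg[OF cal, of "tau y x"] show ?thesis
    by (simp add: defect_def s)
qed

text \<open>Along the backward orbits of \<open>(x, y)\<close> and \<open>(x', y)\<close> the difference of the values of \<open>W - V\<close> does not decrease.
  At multiples of the period the second orbit is back at \<open>(x', y)\<close>, while the first coordinate of
  the first one converges to \<open>x'\<close>; so the difference tends to \<open>0\<close> and was at most \<open>0\<close>
  at the start.\<close>

lemma kernel_minus_subaction_le_periodic:
  assumes inv: "involution_kernel A W" and cal: "calibrated_subaction A V"
    and per: "(backward ^^ k) (x', y) = (x', y)" "0 < k"
    and zero: "\<And>j. defect A V (fst ((backward ^^ j) (x', y))) = 0"
  shows "W (x, y) - V x \<le> W (x', y) - V x'"
proof -
  \<comment> \<open>\<open>b u j\<close> and \<open>s j\<close> are the coordinates of the \<open>j\<close>-th backward iterate of \<open>(u, y)\<close>; the second one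
    does not depend on \<open>u\<close>.\<close>
  define b where "b u j = fst ((backward ^^ j) (u, y))" for u j
  define s where "s j = snd ((backward ^^ j) (x', y))" for j
  have s: "snd ((backward ^^ j) (u, y)) = s j" for u j
    by (rule ext) (simp add: s_def snd_backward_iter)
  have bS: "b u (Suc j) = tau (s j) (b u j)" for u j
    using s[of j u] unfolding b_def by (cases "(backward ^^ j) (u, y)") (simp add: backward_def)
  have sS: "s (Suc j) = shift (s j)" for j
    unfolding s_def by (cases "(backward ^^ j) (x', y)") (simp add: backward_def)
  have le: "(W (x, y) - V x) - (W (x', y) - V x')
      \<le> (W (b x j, s j) - V (b x j)) - (W (b x' j, s j) - V (b x' j))" for j
  proof (induction j)
    case 0
    show ?case by (simp add: b_def s_def)
  next
    case (Suc j)
    have "defect A V (tau (s j) (b x' j)) = 0"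
      using zero[of "Suc j"] by (simp add: bS[symmetric]) (simp add: b_def)
    from kernel_defect_step[OF inv cal this, of "b x j"] Suc
    show ?case by (simp add: bS sS)
  qed
  have fix_iter: "b x' (k * n) = x'" "s (k * n) = y" for n
    using funpow_fixed_multiple[OF per(1), of n] by (simp_all add: b_def s_def)
  have b_lim: "(\<lambda>n. b x (k * n)) \<longlonglongrightarrow> x'"
  proof (rule tendsto_pointI)
    fix i
    show "\<forall>\<^sub>F n in sequentially. b x (k * n) i = x' i"
    proof (rule eventually_sequentiallyI[of "Suc i"])
      fix n assume "Suc i \<le> n"
      also have "n \<le> k * n" using per(2) by simp
      finally have "b x (k * n) i = b x' (k * n) i" by (simp add: b_def fst_backward_iter)
      then show "b x (k * n) i = x' i" by (simp add: fix_iter)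
    qed
  qed
  have cW: "continuous_on UNIV W" and cV: "continuous_on UNIV V"
    using inv cal unfolding involution_kernel_def calibrated_subaction_def by blast+
  have "continuous_on UNIV (\<lambda>u. W (u, y))"
    by (rule continuous_on_compose2[OF cW continuous_on_Pair[OF continuous_on_id continuous_on_const]])
      simp
  then have "continuous_on UNIV (\<lambda>u. W (u, y) - V u)"
    by (rule continuous_on_diff[OF _ cV])
  then have "(\<lambda>n. W (b x (k * n), y) - V (b x (k * n))) \<longlonglongrightarrow> W (x', y) - V x'"
    by (rule continuous_on_tendsto_compose[OF _ b_lim]) auto
  then have "(\<lambda>n. (W (b x (k * n), y) - V (b x (k * n))) - (W (x', y) - V x')) \<longlonglongrightarrow> 0"
    using LIM_zero by blast
  then have "(W (x, y) - V x) - (W (x', y) - V x') \<le> 0"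
    by (rule tendsto_lowerbound) (use le[of "k * _"] in \<open>simp_all add: fix_iter\<close>)
  then show ?thesis by simp
qed

text \<open>The maximality of \<open>u \<mapsto> W (u, b) - V u\<close> at the partner of \<open>b\<close>, applied with the partners
  exchanged, contradicts the strict inequality of the twist condition.\<close>

lemma periodic_support_antitone:
  fixes x x' y y' :: point
  assumes inv: "involution_kernel A W" and cal: "calibrated_subaction A V" and tw: "twist W"
    and orb: "periodic_orbit two_shift S" and zero: "\<And>x. x \<in> fst ` S \<Longrightarrow> defect A V x = 0"
    and S: "(x, y) \<in> S" "(x', y') \<in> S" and less: "x \<prec> x'"
  shows "y' \<preceq> y"
proof (rule ccontr)
  assume "\<not> y' \<preceq> y"
  then have "y \<prec> y'" using lex_linear by blast
  with less tw have "W (x, y) + W (x', y') < W (x, y') + W (x', y)"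
    unfolding twist_def by blast
  moreover have "W (u, b) - V u \<le> W (a, b) - V a" if "(a, b) \<in> S" for u a b
  proof -
    obtain k where k: "0 < k" "\<And>q. q \<in> S \<Longrightarrow> (two_shift ^^ k) q = q"
      "\<And>q. q \<in> S \<Longrightarrow> two_shift q \<in> S"
      using periodic_orbitD[OF orb] by metis
    have fwd: "(two_shift ^^ j) q \<in> S" if "q \<in> S" for j q
      using that by (induction j) (auto intro: k)
    have bwd: "backward q \<in> S" if "q \<in> S" for q
    proof -
      obtain j where "k = Suc j" using k(1) by (cases k) auto
      then have "backward q = (two_shift ^^ j) q"
        using k(2)[OF that] backward_two_shift[of "(two_shift ^^ j) q"] by simp
      then show ?thesis using fwd that by simp
    qed
    have "(backward ^^ j) (a, b) \<in> S" for j
      using that by (induction j) (auto intro: bwd)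
    moreover have "(backward ^^ k) (a, b) = (a, b)"
      using backward_iter_two_shift_iter[of k "(a, b)"] k(2)[OF that] by simp
    ultimately show ?thesis
      using kernel_minus_subaction_le_periodic[OF inv cal _ k(1)] zero by blast
  qed
  from this[OF S(1), of x'] this[OF S(2), of x] have "W (x', y) + W (x, y') \<le> W (x, y) + W (x', y')"
    by simp
  ultimately show False by simp
qed

section \<open>The formula\<close>

theorem theorem7:
  fixes lam \<gamma> :: real
    and A V :: "point \<Rightarrow> real"
    and W :: "point \<times> point \<Rightarrow> real"
    and \<mu> :: "point measure"
    and \<mu>hat :: "(point \<times> point) measure"
    and S :: "(point \<times> point) set"
    and x0 y0 :: point
  assumes "0 < lam" and "lam < 1"
    and "holder lam A"
    and "maximizing A \<mu>" and "\<forall>\<nu>. maximizing A \<nu> \<longrightarrow> \<nu> = \<mu>"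
    and "involution_kernel A W" and "twist W"
    and "calibrated_subaction A V"
    and "natural_extension \<mu> \<mu>hat"
    and "S = measure_support \<mu>hat" and "periodic_orbit two_shift S"
    and "(x0, y0) \<in> S"
    and "\<forall>x \<in> fst ` S. x0 \<preceq> x"
    and "\<forall>y. (x0, y) \<in> S \<longrightarrow> y0 \<preceq> y"
  shows "\<forall>z.
    (\<exists>n X Y. left_list (measure_support \<mu>) S x0 z n X Y) \<and>
    (\<forall>n X Y. left_list (measure_support \<mu>) S x0 z n X Y \<longrightarrow>
       chain_inf (cost A V W \<gamma>) S x0 y0 z = chain_sum (cost A V W \<gamma>) z n X Y \<and>
       (z \<in> measure_support \<mu> \<and> z \<noteq> x0 \<longrightarrow>
          X n \<in> measure_support \<mu> \<and> X n \<prec> z \<and>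
          (\<forall>x \<in> measure_support \<mu>. x \<prec> z \<longrightarrow> x \<preceq> X n)))"
proof -
  note inv = assms(6) and tw = assms(7) and cal = assms(8) and orb = assms(11)
  obtain k where k: "0 < k" "finite S" "\<And>q. q \<in> S \<Longrightarrow> (two_shift ^^ k) q = q"
    "\<And>q. q \<in> S \<Longrightarrow> two_shift q \<in> S"
    using periodic_orbitD[OF orb] by metis
  define P where "P = measure_support \<mu>"
  have P: "P = fst ` S"
    using measure_support_marginal[OF assms(9)] k(2) assms(10) by (simp add: P_def)
  have finP: "finite P" using P k(2) by simp
  have zero: "defect A V x = 0" if "x \<in> P" for x
    using defect_zero_on_support[OF assms(4) cal involution_kernel_continuous[OF inv]] finP that
    by (simp add: P_def)
  have "shift x \<in> P" if "x \<in> P" for x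
    using that k(4) unfolding P by (force simp: two_shift_def)
  then have "(shift ^^ n) x \<in> P" if "x \<in> P" for n x
    using that by (induction n) auto
  then have dev: "deviation A V x = 0" if "x \<in> P" for x
    using that by (intro deviation_zero zero)
  define \<eta> where "\<eta> x = (THE y. (x, y) \<in> S)" for x
  have \<eta>: "(x, y) \<in> S \<longleftrightarrow> x \<in> P \<and> y = \<eta> x" for x y
  proof -
    have "y = y'" if "(x, y) \<in> S" "(x, y') \<in> S" for x y y'
      using two_shift_periodic_fiber k that by blast
    then have "\<eta> x = y" if "(x, y) \<in> S" for x y
      using that unfolding \<eta>_def by blast
    then show ?thesis unfolding P by force
  qed
  have anti: "\<eta> x' \<preceq> \<eta> x" if "x \<in> P" "x' \<in> P" "x \<preceq> x'" for x x'
    using periodic_support_antitone[OF inv cal tw orb, of x "\<eta> x" x' "\<eta> x'"] zero that \<eta>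
    by (auto simp: P)
  have x0: "x0 \<in> P" "\<And>x. x \<in> P \<Longrightarrow> x0 \<preceq> x" "y0 = \<eta> x0"
    using assms(12,13) \<eta> P by auto
  have cost: "chain_sum (cost A V W \<gamma>) z n X Y =
      deviation A V z + ereal (staircase W X Y n + (W (X n, Y n) - W (z, Y n)))"
    if "\<forall>i\<le>n. (X i, Y i) \<in> S" for z n X Y
    using that dev \<eta> by (intro chain_sum_cost) auto

  have ex: "\<exists>n X Y. left_list P S x0 z n X Y" for z
  proof -
    have "\<forall>i\<le>(0::nat). \<forall>r\<in>{x \<in> P. x \<prec> z} - {x0}. x0 \<prec> r" using x0 by auto
    from extend_enumeration[of _ 0 "\<lambda>_. x0", OF _ _ this] finP
    obtain N and e :: "nat \<Rightarrow> point" where e: "\<forall>i<N. e i \<prec> e (Suc i)"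
      "e ` {..N} = (\<lambda>_. x0) ` {..(0::nat)} \<union> ({x \<in> P. x \<prec> z} - {x0})" by auto
    then have im: "e ` {..N} = insert x0 {x \<in> P. x \<prec> z}" by auto
    have "e i \<in> P" if "i \<le> N" for i
    proof -
      have "e i \<in> e ` {..N}" using that by simp
      then show ?thesis using im x0(1) by auto
    qed
    then have "left_list P S x0 z N e (\<eta> \<circ> e)"
      using e im \<eta> by (auto simp: left_list_def)
    then show ?thesis by blast
  qed

  have main: "chain_inf (cost A V W \<gamma>) S x0 y0 z = chain_sum (cost A V W \<gamma>) z n X Y"
    if L: "left_list P S x0 z n X Y" for z n X Y
  proof -
    have inc: "\<forall>i<n. X i \<prec> X (Suc i)" and im: "X ` {..n} = insert x0 {x \<in> P. x \<prec> z}"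
      and XY: "\<forall>i\<le>n. (X i, Y i) \<in> S" using L by (auto simp: left_list_def)
    have XP: "X i \<in> P" "Y i = \<eta> (X i)" if "i \<le> n" for i using XY \<eta> that by auto
    have mem: "X i = x0 \<or> X i \<prec> z" if "i \<le> n" for i
    proof -
      have "X i \<in> X ` {..n}" using that by simp
      then show ?thesis unfolding im by auto
    qed
    have X0: "X 0 = x0"
    proof -
      have "x0 \<in> X ` {..n}" unfolding im by simp
      then obtain i where i: "i \<le> n" "x0 = X i" by auto
      show ?thesis
      proof (cases i)
        case (Suc j)
        then have "X 0 \<prec> x0" using lex_mono_enumeration[OF inc, of 0 i] i by simp
        then show ?thesis using x0(2)[OF XP(1)[of 0]] less_fun_asym by blast
      qed (use i in simp)
    qed
    have left: "n = 0 \<or> X n \<prec> z"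
    proof (cases n)
      case (Suc m)
      then have "X 0 \<prec> X n" using lex_mono_enumeration[OF inc, of 0 n] by simp
      then have "X n \<noteq> x0" using X0 less_fun_irrefl by metis
      then show ?thesis using mem[of n] by simp
    qed simp
    \<comment> \<open>The rest of the support lies to the right of the list, and not to the left of \<open>z\<close>.\<close>
    define R where "R = P - X ` {..n}"
    have R: "x0 \<prec> r" "z \<preceq> r" if "r \<in> R" for r
      using that x0(2)[of r] lex_linear[of r z] im by (auto simp: R_def)
    have "\<forall>i\<le>n. \<forall>r\<in>R. X i \<prec> r"
    proof (intro allI impI ballI)
      fix i r assume "i \<le> n" "r \<in> R"
      then show "X i \<prec> r"
        using mem[of i] R[OF \<open>r \<in> R\<close>] less_fun_trans[of "X i" z r] by auto
    qed
    from extend_enumeration[OF _ inc this] finP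
    obtain N and e :: "nat \<Rightarrow> point" where e: "n \<le> N" "\<And>i. i \<le> n \<Longrightarrow> e i = X i" "\<forall>i<N. e i \<prec> e (Suc i)"
      "e ` {..N} = X ` {..n} \<union> R" by (auto simp: R_def)
    have eP: "e ` {..N} = P" using e(4) XP(1) by (auto simp: R_def)
    define h where "h = \<eta> \<circ> e"
    have dec: "\<forall>j\<le>N. \<forall>i\<le>j. h j \<preceq> h i"
    proof (intro allI impI)
      fix i j assume that: "j \<le> N" "i \<le> j"
      have "e i \<preceq> e j" using lex_mono_enumeration[OF e(3), of i j] that by (cases "i = j") auto
      moreover have "e i \<in> P" "e j \<in> P" using eP that by auto
      ultimately show "h j \<preceq> h i" using anti unfolding h_def comp_def by blast
    qed
    have right: "z \<preceq> e (Suc n)" if "n < N"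
    proof -
      have "e (Suc n) \<in> X ` {..n} \<union> R" using e(4) that by auto
      moreover have "e (Suc n) \<notin> X ` {..n}"
      proof
        assume "e (Suc n) \<in> X ` {..n}"
        then obtain i where "i \<le> n" "e (Suc n) = e i" using e(2) by auto
        then show False using lex_mono_enumeration[OF e(3), of i "Suc n"] that by auto
      qed
      ultimately show ?thesis using R by blast
    qed
    have stair: "staircase W X Y n = staircase W e h n" "X n = e n" "Y n = h n"
      using e(2) XP(2) by (auto simp: staircase_def h_def intro!: sum.cong)
    have lower: "chain_sum (cost A V W \<gamma>) z n X Y \<le> chain_sum (cost A V W \<gamma>) z m X' Y'"
      if c: "X' 0 = x0" "Y' 0 = y0" "\<forall>j\<in>{1..m}. (X' j, Y' j) \<in> S" for m X' Y'
    proof -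
      have S': "\<forall>j\<le>m. (X' j, Y' j) \<in> S"
      proof (intro allI impI)
        fix j assume "j \<le> m"
        then show "(X' j, Y' j) \<in> S" using c assms(12) by (cases j) auto
      qed
      \<comment> \<open>A competing chain is a walk on the indices of the enumeration that starts at \<open>0\<close>.\<close>
      have "\<exists>i\<le>N. e i = X' j \<and> (j = 0 \<longrightarrow> i = 0)" if "j \<le> m" for j
      proof (cases "j = 0")
        case True
        then show ?thesis using c X0 e(2)[of 0] by auto
      next
        case False
        then show ?thesis using S' that \<eta> eP by (metis atMost_iff imageE)
      qed
      then obtain \<kappa> where \<kappa>: "\<And>j. j \<le> m \<Longrightarrow> \<kappa> j \<le> N \<and> e (\<kappa> j) = X' j \<and> (j = 0 \<longrightarrow> \<kappa> j = 0)"
        by metis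
      have hY: "h (\<kappa> j) = Y' j" if "j \<le> m" for j
        using \<kappa>[OF that] S' \<eta> that by (auto simp: h_def)
      have "staircase W (e \<circ> \<kappa>) (h \<circ> \<kappa>) m = staircase W X' Y' m"
        using \<kappa> hY by (auto simp: staircase_def intro!: sum.cong)
      moreover have "staircase W e h n + (W (e n, h n) - W (z, h n))
          \<le> staircase W (e \<circ> \<kappa>) (h \<circ> \<kappa>) m + (W (e (\<kappa> m), h (\<kappa> m)) - W (z, h (\<kappa> m)))"
        using staircase_le_chain[OF tw e(3) dec e(1) _ right, of \<kappa> m] left \<kappa> stair by auto
      ultimately show ?thesis
        using \<kappa>[of m] hY[of m] stair by (simp add: cost[OF XY] cost[OF S'] add_left_mono)
    qed
    have "Y 0 = y0" using XP(2)[of 0] X0 x0(3) by simp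
    then have "chain_sum (cost A V W \<gamma>) z n X Y \<in> {chain_sum (cost A V W \<gamma>) z n X Y | n X Y.
            X 0 = x0 \<and> Y 0 = y0 \<and> (\<forall>j\<in>{1..n}. (X j, Y j) \<in> S)}"
      using X0 XY by fastforce
    then show ?thesis unfolding chain_inf_def
      by (intro antisym Inf_lower Inf_greatest) (auto intro: lower)
  qed

  have last: "X n \<in> P \<and> X n \<prec> z \<and> (\<forall>x \<in> P. x \<prec> z \<longrightarrow> x \<preceq> X n)"
    if L: "left_list P S x0 z n X Y" and z: "z \<in> P" "z \<noteq> x0" for z n X Y
  proof -
    have inc: "\<forall>i<n. X i \<prec> X (Suc i)" and im: "X ` {..n} = insert x0 {x \<in> P. x \<prec> z}"
      using L by (auto simp: left_list_def)
    have "x0 \<prec> z" using x0(2) z by blast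
    then have im': "X ` {..n} = {x \<in> P. x \<prec> z}" using im x0(1) by auto
    moreover have "X n \<in> X ` {..n}" by simp
    ultimately have "X n \<in> P \<and> X n \<prec> z" by auto
    moreover have "x \<preceq> X n" if "x \<in> P" "x \<prec> z" for x
    proof -
      have "x \<in> X ` {..n}" using im' that by simp
      then obtain i where "i \<le> n" "x = X i" by auto
      then show ?thesis using lex_mono_enumeration[OF inc, of i n] by (cases "i = n") auto
    qed
    ultimately show ?thesis by blast
  qed
  show ?thesis using ex main last unfolding P_def by blast
qed

end
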